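(* Let $n\ge2$ and let $P$ be a regular game on $n$ players. Then $P$ is transitive if and only if it is a weak separable ordinal potential game, namely if and only if there exists a vector $\Phi\in\mathbb R^n$ such that $$P_{ij}>0\Leftrightarrow \Phi_i-\Phi_j>0\qquad\text{for all } i,j.$$ Moreover, when $P$ is transitive, the potential $\Phi$ can be chosen as the Elo rating $\varepsilon^{\varphi_\beta(P)}$ of $\varphi_\beta(P)$, where $\varphi_\beta(x):=\frac1\beta\tanh(\beta x)$ and $\beta>\max\left(\frac{n-1}{x_\alpha},\beta_\alpha\right)$, with $\alpha$, $x_\alpha$, $\beta_\alpha$ as defined in the context.
   Context: A game on $n$ players is an antisymmetric real $n\times n$ matrix $P$ ($P=-P^T$) with entries in $[-1,1]$; it is viewed as a two-player symmetric zero-sum game. Put $\widetilde P_{ij}:=\frac{1+P_{ij}}{2}$. $P$ is regular if $P_{ij}\neq0$ for all $i\ne j$. $P$ is transitive if, for all $i,j,k$, $P_{ij}>0$ and $P_{jk}>0$ imply $P_{ik}>0$. $P$ is an ordinal potential game if there is a real $n\times n$ matrix $\widetilde\Phi$ such that, for all $i,j,k$, $$P_{ij}-P_{kj}>0\Leftrightarrow\widetilde\Phi_{ij}-\widetilde\Phi_{kj}>0\Leftrightarrow\widetilde\Phi_{ji}-\widetilde\Phi_{jk}>0.$$ $P$ is a weak separable ordinal potential game if there is a matrix $\widetilde\Phi$ which is additively separable, i.e. $\widetilde\Phi_{ij}=a_i+b_j$ for some vectors $a,b\in\mathbb R^n$, and for which the displayed equivalences hold for all $i$ and all $j=k$ (as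 opposed to all $i,j,k$). Let $\sigma(x)=(1+e^{-x})^{-1}$ and $\mathrm{bce}(y,\hat y):=-y\ln\hat y-(1-y)\ln(1-\hat y)$. The Elo rating $\varepsilon^P\in\mathbb R^n$ of a game $P$ is a minimizer over $\varepsilon\in\mathbb R^n$ of $\sum_{i,j}\mathrm{bce}\left(\widetilde P_{ij},\sigma(\varepsilon_i-\varepsilon_j)\right)$. A real function applied to a matrix is applied entrywise. Parameters: $\alpha$ is any number with $0<\alpha<\frac{2}{n(n-1)}$; $x_\alpha$ is the unique positive root of $2\,\mathrm{arctanh}^3(x)-3\alpha x$; with $P_{max}:=\max_{i,j}P_{ij}$ and $P_{min}:=\min_{(i,j):\,P_{ij}>0}P_{ij}$, $\beta_\alpha>0$ is any number such that $\frac{\tanh(\beta_\alpha P_{max})}{\tanh(\beta_\alpha P_{min})}\le\frac{n}{n-2+n(n-1)\alpha}$. *)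

theory Defs
  imports "HOL-Analysis.Analysis"
begin

definition is_game :: "real^'n^'n \<Rightarrow> bool" where
  "is_game P \<longleftrightarrow> P = - transpose P \<and> (\<forall>i j. P $ i $ j \<in> {-1..1})"

definition regular_game :: "real^'n^'n \<Rightarrow> bool" where
  "regular_game P \<longleftrightarrow> (\<forall>i j. i \<noteq> j \<longrightarrow> P $ i $ j \<noteq> 0)"

definition transitive_game :: "real^'n^'n \<Rightarrow> bool" where
  "transitive_game P \<longleftrightarrow> (\<forall>i j k. P $ i $ j > 0 \<and> P $ j $ k > 0 \<longrightarrow> P $ i $ k > 0)"

definition win_prob :: "real^'n^'n \<Rightarrow> real^'n^'n" where
  "win_prob P = (\<chi> i j. (1 + P $ i $ j) / 2)"

text \<open>The chain of equivalences defining an ordinal potential, at one triple \<open>i, j, k\<close>: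
  an ordinal potential game requires it for all triples, a weak one only for those
  with \<open>k = j\<close>.\<close>

definition ordinal_potential_at :: "real^'n^'n \<Rightarrow> real^'n^'n \<Rightarrow> 'n \<Rightarrow> 'n \<Rightarrow> 'n \<Rightarrow> bool" where
  "ordinal_potential_at P F i j k \<longleftrightarrow>
     (P $ i $ j - P $ k $ j > 0 \<longleftrightarrow> F $ i $ j - F $ k $ j > 0) \<and>
     (F $ i $ j - F $ k $ j > 0 \<longleftrightarrow> F $ j $ i - F $ j $ k > 0)"

definition additively_separable :: "real^'n^'n \<Rightarrow> bool" where
  "additively_separable F \<longleftrightarrow> (\<exists>a b :: real^'n. \<forall>i j. F $ i $ j = a $ i + b $ j)"

definition weak_separable_ordinal_potential_game :: "real^'n^'n \<Rightarrow> bool" where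
  "weak_separable_ordinal_potential_game P \<longleftrightarrow>
     (\<exists>F. additively_separable F \<and> (\<forall>i j. ordinal_potential_at P F i j j))"

definition represents_wins :: "real^'n^'n \<Rightarrow> real^'n \<Rightarrow> bool" where
  "represents_wins P v \<longleftrightarrow> (\<forall>i j. P $ i $ j > 0 \<longleftrightarrow> v $ i - v $ j > 0)"

definition sigmoid :: "real \<Rightarrow> real" where
  "sigmoid x = inverse (1 + exp (- x))"

definition bce :: "real \<Rightarrow> real \<Rightarrow> real" where
  "bce y z = - y * ln z - (1 - y) * ln (1 - z)"

definition elo_loss :: "real^'n^'n \<Rightarrow> real^'n \<Rightarrow> real" where
  "elo_loss P e = (\<Sum>i\<in>UNIV. \<Sum>j\<in>UNIV. bce (win_prob P $ i $ j) (sigmoid (e $ i - e $ j)))"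

text \<open>A predicate rather than a function: minimizers are never unique, since the loss is
  invariant under adding a constant to all ratings.\<close>

definition is_elo_rating :: "real^'n^'n \<Rightarrow> real^'n \<Rightarrow> bool" where
  "is_elo_rating P e \<longleftrightarrow> is_arg_min (elo_loss P) (\<lambda>_. True) e"

definition scaled_tanh :: "real \<Rightarrow> real \<Rightarrow> real" where
  "scaled_tanh \<beta> x = 1 / \<beta> * tanh (\<beta> * x)"

text \<open>The upper bound \<open>x < 1\<close> is the domain of the real inverse hyperbolic tangent;
  the library's \<open>artanh\<close> is total, with arbitrary values outside \<open>{-1<..<1}\<close>.\<close>

definition x_root :: "real \<Rightarrow> real" where
  "x_root \<alpha> = (THE x. 0 < x \<and> x < 1 \<and> 2 * artanh x ^ 3 - 3 * \<alpha> * x = 0)"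

definition P_max :: "real^'n^'n \<Rightarrow> real" where
  "P_max P = Max {P $ i $ j | i j. True}"

definition P_min :: "real^'n^'n \<Rightarrow> real" where
  "P_min P = Min {P $ i $ j | i j. P $ i $ j > 0}"

end

(* The first-order condition for an Elo rating e of a game says that each row of sigmoid (e_k - e_j)
   has the same sum as the corresponding row of winning probabilities. Since the sigmoid is
   increasing, e orders the players by these row sums. If all positive entries of a transitive
   game lie in [m, M] and i beats j, then the row sums of i and j differ by at least
   2 m + (n - 2) (m - M), because no third player k can beat i and lose to j. The bound on beta
   makes this positive for the compressed game; it passes from beta_alpha to larger beta because
   tanh (beta p) / tanh (beta q) decreases in beta for q <= p. *)

theory Submission
  imports Defs
begin

section \<open>Antisymmetry and trichotomy of regular games\<close>

lemma game_antisym: "is_game P \<Longrightarrow> P $ j $ i = - P $ i $ j"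
proof -
  assume "is_game P"
  then have "P $ j $ i = (- transpose P) $ j $ i" by (simp add: is_game_def)
  then show ?thesis by (simp add: transpose_def)
qed

lemma game_diag: "is_game P \<Longrightarrow> P $ i $ i = 0"
  using game_antisym[of P i i] by simp

lemma game_abs_le_1: "is_game P \<Longrightarrow> \<bar>P $ i $ j\<bar> \<le> 1"
  by (simp add: is_game_def abs_le_iff)

lemma regular_game_cases:
  assumes "is_game P" "regular_game P"
  obtains "i = j" | "P $ i $ j > 0" | "P $ j $ i > 0"
  using assms(2) game_antisym[OF assms(1), of j i] unfolding regular_game_def
  by (cases "P $ i $ j" "0 :: real" rule: linorder_cases) auto

section \<open>Transitivity and separable potentials\<close>

text \<open>The converse implication is free: if \<open>v\<close> ranks i above j although i does
  not beat j, then regularity makes j beat i, which would rank j above i.\<close>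

lemma represents_winsI:
  assumes "is_game P" "regular_game P"
    and wins: "\<And>i j. P $ i $ j > 0 \<Longrightarrow> v $ i > v $ j"
  shows "represents_wins P v"
  unfolding represents_wins_def
proof (intro allI iffI)
  fix i j
  show "v $ i - v $ j > 0" if "P $ i $ j > 0"
    using wins[OF that] by simp
  show "P $ i $ j > 0" if "v $ i - v $ j > 0"
    using assms(1,2)
  proof (cases rule: regular_game_cases[of P i j])
    case 3
    then show ?thesis using wins[of j i] that by simp
  qed (use that in auto)
qed

text \<open>The potential counts the players beaten. If i beats j, transitivity hands i every win of
  j, and i also beats j, whom j does not beat.\<close>

lemma transitive_imp_represents_wins:
  assumes "is_game P" "regular_game P" "transitive_game P"
  shows "represents_wins P (\<chi> i. real (card {k. P $ i $ k > 0}))"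
proof (rule represents_winsI[OF assms(1,2)])
  fix i j assume ij: "P $ i $ j > 0"
  have "{k. P $ j $ k > 0} \<subseteq> {k. P $ i $ k > 0}"
    using ij assms(3) unfolding transitive_game_def by blast
  moreover have "j \<in> {k. P $ i $ k > 0} - {k. P $ j $ k > 0}"
    using ij game_diag[OF assms(1), of j] by simp
  ultimately have "{k. P $ j $ k > 0} \<subset> {k. P $ i $ k > 0}" by blast
  then have "card {k. P $ j $ k > 0} < card {k. P $ i $ k > 0}"
    by (rule psubset_card_mono[OF finite])
  then show "(\<chi> i. real (card {k. P $ i $ k > 0})) $ j < (\<chi> i. real (card {k. P $ i $ k > 0})) $ i"
    by simp
qed

lemma represents_wins_imp_transitive:
  "represents_wins P v \<Longrightarrow> transitive_game P"
  unfolding represents_wins_def transitive_game_def by fastforce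

text \<open>At k = j the diagonal entry of P vanishes and F_ij - F_jj = a_i - a_j: the column part
  cancels, and \<open>a\<close> itself is the potential.\<close>

lemma weak_separable_iff_represents_wins:
  assumes "is_game P"
  shows "weak_separable_ordinal_potential_game P \<longleftrightarrow> (\<exists>v. represents_wins P v)"
proof
  assume "weak_separable_ordinal_potential_game P"
  then obtain F a b where "\<And>i j. F $ i $ j = a $ i + b $ j" "\<And>i j. ordinal_potential_at P F i j j"
    unfolding weak_separable_ordinal_potential_game_def additively_separable_def by blast
  then have "represents_wins P a"
    unfolding represents_wins_def ordinal_potential_at_def by (simp add: game_diag[OF assms])
  then show "\<exists>v. represents_wins P v" ..
next
  assume "\<exists>v. represents_wins P v"
  then obtain v where v: "represents_wins P v" ..
  \<comment> \<open>Equal row and column parts make F symmetric, so the second equivalence becomes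
    trivial.\<close>
  define F where "F = (\<chi> i j. v $ i + v $ j)"
  have "additively_separable F"
    unfolding additively_separable_def F_def by auto
  moreover have "ordinal_potential_at P F i j j" for i j
    using v unfolding represents_wins_def ordinal_potential_at_def F_def
    by (simp add: game_diag[OF assms])
  ultimately show "weak_separable_ordinal_potential_game P"
    unfolding weak_separable_ordinal_potential_game_def by blast
qed

section \<open>Existence and characterisation of Elo ratings\<close>

lemma sigmoid_minus: "sigmoid (- x) = 1 - sigmoid x"
proof -
  have "1 + exp x > 0" by (simp add: add_pos_pos)
  then show ?thesis unfolding sigmoid_def by (simp add: exp_minus field_simps)
qed

lemma sigmoid_mono: "x \<le> y \<Longrightarrow> sigmoid x \<le> sigmoid y"
  unfolding sigmoid_def by (simp add: le_imp_inverse_le add_pos_pos)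

text \<open>Softplus form, from which growth, derivative and continuity of the loss are read
  off.\<close>

lemma bce_sigmoid:
  "bce y (sigmoid d) = y * ln (1 + exp (- d)) + (1 - y) * ln (1 + exp d)"
proof -
  have "ln (sigmoid d) = - ln (1 + exp (- d))" for d
    unfolding sigmoid_def by (simp add: ln_inverse add_pos_pos)
  from this[of d] this[of "- d"] show ?thesis
    unfolding bce_def by (simp add: sigmoid_minus algebra_simps)
qed

text \<open>Softplus dominates the positive part, and both weights y and 1 - y are at least c, so
  the loss grows linearly in either direction. Coercivity rests on this.\<close>

lemma bce_sigmoid_ge:
  assumes "c \<le> y" "y \<le> 1 - c" "c \<ge> 0"
  shows "bce y (sigmoid d) \<ge> c * \<bar>d\<bar>"
proof -
  have ln_ge: "ln (1 + exp x) \<ge> max 0 x" for x :: real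
    by (smt (verit) exp_gt_zero ln_exp ln_ge_zero ln_le_cancel_iff)
  have "c * \<bar>d\<bar> = c * max 0 (- d) + c * max 0 d"
    by (auto simp: max_def abs_if)
  also have "\<dots> \<le> y * ln (1 + exp (- d)) + (1 - y) * ln (1 + exp d)"
    using assms ln_ge[of d] ln_ge[of "- d"] by (intro add_mono mult_mono) auto
  finally show ?thesis by (simp add: bce_sigmoid)
qed

lemma bce_sigmoid_has_derivative:
  "((\<lambda>d. bce y (sigmoid d)) has_real_derivative sigmoid d - y) (at d)"
proof -
  have pos: "1 + exp x > 0" "1 + exp x \<noteq> 0" for x :: real
    by (smt (verit) exp_gt_zero)+
  have "((\<lambda>d. y * ln (1 + exp (- d)) + (1 - y) * ln (1 + exp d)) has_real_derivative
      y * - (exp (- d) / (1 + exp (- d))) + (1 - y) * (exp d / (1 + exp d))) (at d)"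
    by (auto intro!: derivative_eq_intros simp: pos mult_ac)
  moreover have "exp x / (1 + exp x) = sigmoid x" for x :: real
    unfolding sigmoid_def using pos[of x] by (simp add: exp_minus field_simps)
  from this[of d] this[of "- d"]
  have "y * - (exp (- d) / (1 + exp (- d))) + (1 - y) * (exp d / (1 + exp d)) = sigmoid d - y"
    by (simp only: sigmoid_minus) (simp add: algebra_simps)
  ultimately show ?thesis
    by (simp add: bce_sigmoid)
qed

section \<open>Existence of a minimizer\<close>

lemma elo_loss_shift: "elo_loss P (\<chi> i. e $ i - t) = elo_loss P e"
  unfolding elo_loss_def by simp

lemma continuous_on_elo_loss: "continuous_on S (elo_loss P)"
proof -
  have "1 + exp x \<noteq> 0" for x :: real
    by (smt (verit) exp_gt_zero)
  then show ?thesis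
    unfolding elo_loss_def bce_sigmoid by (intro continuous_intros) auto
qed

text \<open>The bound keeps all winning probabilities in [c, 1 - c]. All summands are then
  nonnegative, so the one at (k, l) alone bounds the loss from below.\<close>

lemma elo_loss_ge:
  fixes P :: "real^'n^'n"
  assumes bound: "\<And>i j. \<bar>P $ i $ j\<bar> \<le> 1 - 2 * c" and "c \<ge> 0"
  shows "elo_loss P e \<ge> c * \<bar>e $ k - e $ l\<bar>"
proof -
  have term_ge: "bce (win_prob P $ i $ j) (sigmoid (e $ i - e $ j)) \<ge> c * \<bar>e $ i - e $ j\<bar>" for i j
    using bound[of i j] \<open>c \<ge> 0\<close> by (intro bce_sigmoid_ge) (auto simp: win_prob_def)
  then have nonneg: "bce (win_prob P $ i $ j) (sigmoid (e $ i - e $ j)) \<ge> 0" for i j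
    using \<open>c \<ge> 0\<close> by (meson abs_ge_zero mult_nonneg_nonneg order_trans)
  have "c * \<bar>e $ k - e $ l\<bar> \<le> bce (win_prob P $ k $ l) (sigmoid (e $ k - e $ l))"
    by (rule term_ge)
  also have "\<dots> \<le> (\<Sum>j\<in>UNIV. bce (win_prob P $ k $ j) (sigmoid (e $ k - e $ j)))"
    by (rule member_le_sum) (auto simp: nonneg)
  also have "\<dots> \<le> elo_loss P e"
    unfolding elo_loss_def
    by (rule member_le_sum[where f = "\<lambda>i. \<Sum>j\<in>UNIV. bce (win_prob P $ i $ j) (sigmoid (e $ i - e $ j))"])
      (auto simp: nonneg sum_nonneg)
  finally show ?thesis .
qed

text \<open>Modulo shifts one rating may be fixed to 0; the loss is coercive on that slice.\<close>

lemma elo_rating_exists: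
  fixes P :: "real^'n^'n"
  assumes bound: "\<And>i j. \<bar>P $ i $ j\<bar> \<le> q" and "q < 1"
  shows "\<exists>e. is_elo_rating P e"
proof -
  \<comment> \<open>Chosen so that 1 - 2 * c = q; beyond a rating difference \<open>R\<close> the
    loss exceeds its value at 0.\<close>
  define c where "c = (1 - q) / 2"
  define R where "R = elo_loss P 0 / c"
  have "c > 0" using \<open>q < 1\<close> by (simp add: c_def)
  have loss_ge: "elo_loss P e \<ge> c * \<bar>e $ k - e $ l\<bar>" for e k l
    using bound \<open>c > 0\<close> by (intro elo_loss_ge) (auto simp: c_def diff_divide_distrib)
  have "R \<ge> 0"
    using loss_ge[where e = 0] \<open>c > 0\<close> by (simp add: R_def)
  define K :: "(real^'n) set" where "K = cbox (\<chi> i. - R) (\<chi> i. R)"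
  have memK: "e \<in> K \<longleftrightarrow> (\<forall>i. \<bar>e $ i\<bar> \<le> R)" for e
    by (simp add: K_def mem_box_cart abs_le_iff) (smt (verit))
  have "compact K" by (simp add: K_def)
  moreover have "0 \<in> K" using \<open>R \<ge> 0\<close> by (simp add: memK)
  ultimately obtain e where "e \<in> K" and e: "\<And>x. x \<in> K \<Longrightarrow> elo_loss P e \<le> elo_loss P x"
    using continuous_attains_inf[OF _ _ continuous_on_elo_loss, of K P] by blast
  have "elo_loss P e \<le> elo_loss P x" for x
  proof -
    \<comment> \<open>Any k serves as the reference player whose rating is shifted to 0; leaving the
      box then means a difference to k larger than \<open>R\<close>.\<close>
    obtain k :: 'n where True by simp
    define x' where "x' = (\<chi> i. x $ i - x $ k)"
    have "elo_loss P e \<le> elo_loss P x'"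
    proof (cases "x' \<in> K")
      case False
      then obtain i where "\<bar>x' $ i - x' $ k\<bar> > R"
        by (auto simp: memK not_le x'_def)
      then have "elo_loss P 0 < c * \<bar>x' $ i - x' $ k\<bar>"
        using \<open>c > 0\<close> by (simp add: R_def field_simps)
      then show ?thesis
        using loss_ge[of x' i k] e[OF \<open>0 \<in> K\<close>] by simp
    qed (rule e)
    then show ?thesis by (simp add: x'_def elo_loss_shift)
  qed
  then show ?thesis
    unfolding is_elo_rating_def is_arg_min_linorder by blast
qed

text \<open>The derivative of the loss along the k-th unit vector vanishes at a minimizer. The pairs
  (k, j) and (j, k) contribute equally, so it is twice the sum of \<open>D k j\<close> over
  j.\<close>

lemma elo_rating_row_sum:
  fixes P :: "real^'n^'n"
  assumes "is_game P" "is_elo_rating P e"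
  shows "(\<Sum>j\<in>UNIV. sigmoid (e $ k - e $ j)) = (\<Sum>j\<in>UNIV. win_prob P $ k $ j)"
proof -
  define D :: "'n \<Rightarrow> 'n \<Rightarrow> real" where "D i j = sigmoid (e $ i - e $ j) - win_prob P $ i $ j" for i j
  define \<delta> :: "'n \<Rightarrow> real" where "\<delta> i = of_bool (i = k)" for i
  define f where "f t = elo_loss P (\<chi> i. e $ i + t * \<delta> i)" for t
  have D_anti: "D j i = - D i j" for i j
    using sigmoid_minus[of "e $ i - e $ j"] game_antisym[OF assms(1), of j i]
    by (simp add: D_def win_prob_def field_simps)
  have "((\<lambda>t. bce (win_prob P $ i $ j) (sigmoid ((e $ i + t * \<delta> i) - (e $ j + t * \<delta> j))))
      has_real_derivative D i j * (\<delta> i - \<delta> j)) (at 0)" for i j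
    unfolding D_def
    by (rule DERIV_chain2[where f = "\<lambda>d. bce (win_prob P $ i $ j) (sigmoid d)"])
      (auto intro!: derivative_eq_intros bce_sigmoid_has_derivative[THEN DERIV_cong])
  then have "(f has_real_derivative (\<Sum>i\<in>UNIV. \<Sum>j\<in>UNIV. D i j * (\<delta> i - \<delta> j))) (at 0)"
    unfolding f_def elo_loss_def by (auto intro!: DERIV_sum)
  moreover have "f 0 \<le> f t" for t
    using assms(2) unfolding f_def is_elo_rating_def is_arg_min_linorder by simp
  \<comment> \<open>The minimum is global, so the radius 1 is an arbitrary choice.\<close>
  ultimately have "(\<Sum>i\<in>UNIV. \<Sum>j\<in>UNIV. D i j * (\<delta> i - \<delta> j)) = 0"
    by (intro DERIV_local_min[of f _ 0 1]) auto
  \<comment> \<open>Antisymmetry of \<open>D\<close> makes the subtracted half the negative of the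
    other one: the halves add up instead of cancelling.\<close>
  moreover have "(\<Sum>i\<in>UNIV. \<Sum>j\<in>UNIV. D i j * \<delta> j) = - (\<Sum>i\<in>UNIV. \<Sum>j\<in>UNIV. D i j * \<delta> i)"
    by (subst sum.swap) (simp add: D_anti[of _ k] sum_negf \<delta>_def)
  moreover have "(\<Sum>i\<in>UNIV. \<Sum>j\<in>UNIV. D i j * \<delta> i) = (\<Sum>j\<in>UNIV. D k j)"
    by (subst sum.swap) (simp add: \<delta>_def)
  ultimately have "(\<Sum>j\<in>UNIV. D k j) = 0"
    by (simp add: right_diff_distrib sum_subtractf)
  then show ?thesis
    by (simp add: D_def sum_subtractf)
qed

text \<open>By contraposition: e_i \<le> e_j compares the sigmoid rows termwise, and the row sum
  identity carries this over to P.\<close>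

lemma elo_rating_less:
  fixes P :: "real^'n^'n"
  assumes "is_game P" "is_elo_rating P e"
    and less: "(\<Sum>k\<in>UNIV. P $ j $ k) < (\<Sum>k\<in>UNIV. P $ i $ k)"
  shows "e $ j < e $ i"
proof (rule ccontr)
  assume "\<not> e $ j < e $ i"
  then have "(\<Sum>k\<in>UNIV. sigmoid (e $ i - e $ k)) \<le> (\<Sum>k\<in>UNIV. sigmoid (e $ j - e $ k))"
    by (intro sum_mono sigmoid_mono) simp
  then have "(\<Sum>k\<in>UNIV. (1 + P $ i $ k) / 2) \<le> (\<Sum>k\<in>UNIV. (1 + P $ j $ k) / 2)"
    by (simp add: elo_rating_row_sum[OF assms(1,2)] win_prob_def)
  with less show False
    by (simp add: sum_divide_distrib[symmetric] sum.distrib divide_le_cancel)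
qed

section \<open>Row sums of transitive games\<close>

lemma transitive_row_sum_diff_ge:
  fixes P :: "real^'n^'n"
  assumes game: "is_game P" and regular: "regular_game P" and trans: "transitive_game P"
    and ge: "\<And>i j. P $ i $ j > 0 \<Longrightarrow> P $ i $ j \<ge> m"
    and le: "\<And>i j. P $ i $ j > 0 \<Longrightarrow> P $ i $ j \<le> M"
    and "0 < m" "m \<le> M" and ij: "P $ i $ j > 0"
  shows "real CARD('n) * m - (real CARD('n) - 2) * M
    \<le> (\<Sum>k\<in>UNIV. P $ i $ k) - (\<Sum>k\<in>UNIV. P $ j $ k)"
proof -
  have "i \<noteq> j" using ij game_diag[OF game, of i] by auto
  have anti: "P $ y $ x = - P $ x $ y" for x y by (rule game_antisym[OF game])
  \<comment> \<open>If i beats k, at worst j beats k by M. If k beats i, then k beats j as well, so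
    a loss of at most M is offset by at least m.\<close>
  have "m - M \<le> P $ i $ k - P $ j $ k" if "k \<in> UNIV - {i, j}" for k
  proof (cases rule: regular_game_cases[OF game regular, of i k])
    case 1 then show ?thesis using that by simp
  next
    case 2
    then show ?thesis
      using ge[OF 2] le[of j k] \<open>0 < m\<close> \<open>m \<le> M\<close> by (cases "P $ j $ k > 0") auto
  next
    case 3
    then have "P $ k $ j > 0"
      using ij trans unfolding transitive_game_def by blast
    then show ?thesis using ge[of k j] le[OF 3] anti[of i k] anti[of j k] by simp
  qed
  then have "real (card (UNIV - {i, j})) * (m - M) \<le> (\<Sum>k\<in>UNIV - {i, j}. P $ i $ k - P $ j $ k)"
    by (rule sum_bounded_below)
  moreover have "real (card (UNIV - {i, j})) = real CARD('n) - 2"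
  proof -
    \<comment> \<open>With n \<ge> 2 the truncated subtraction in the cardinality agrees with the
      real n - 2.\<close>
    have "card {i, j} \<le> CARD('n)" by (rule card_mono) auto
    then show ?thesis using \<open>i \<noteq> j\<close> by (simp add: card_Diff_subset)
  qed
  \<comment> \<open>The terms at k = i and k = j both equal P_ij.\<close>
  moreover have "(\<Sum>k\<in>UNIV. P $ i $ k - P $ j $ k)
      = (\<Sum>k\<in>UNIV - {i, j}. P $ i $ k - P $ j $ k) + 2 * P $ i $ j"
    using \<open>i \<noteq> j\<close> anti[of i j] game_diag[OF game]
    by (subst sum.subset_diff[of "{i, j}"]) auto
  ultimately show ?thesis
    using ge[OF ij] by (simp add: sum_subtractf algebra_simps)
qed

section \<open>The compression \<open>scaled_tanh\<close>\<close>

text \<open>On the nonnegative axis sinh is convex and vanishes at 0, so it lies below its chord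
  from 0 to x; in other words, sinh t / t increases.\<close>

lemma mult_sinh_le:
  fixes x y :: real
  assumes "0 \<le> y" "y \<le> x"
  shows "x * sinh y \<le> y * sinh x"
proof (cases "x = 0")
  case False
  have "convex_on {0..} (sinh :: real \<Rightarrow> real)"
    by (rule convex_on_realI[where f' = cosh]) (auto intro!: derivative_eq_intros simp: cosh_real_nonneg_le_iff)
  from convex_onD[OF this, of "y / x" 0 x] show ?thesis
    using assms False by (simp add: field_simps)
qed (use assms in auto)

text \<open>By the quotient rule the derivative has the sign of
  \<open>p * (sinh v * cosh v) - q * (sinh u * cosh u)\<close>, which is nonpositive because sinh t
  / t increases.\<close>

lemma tanh_ratio_antimono:
  fixes p q :: real
  assumes "0 < q" "q \<le> p" "0 < b" "b \<le> B"
  shows "tanh (B * p) / tanh (B * q) \<le> tanh (b * p) / tanh (b * q)"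
proof (rule DERIV_nonpos_imp_nonincreasing[OF \<open>b \<le> B\<close>])
  fix x assume "b \<le> x" "x \<le> B"
  then have "x > 0" using assms by simp
  define u v where "u = x * p" and "v = x * q"
  have uv: "0 < v" "v \<le> u" using assms \<open>x > 0\<close> by (simp_all add: u_def v_def)
  \<comment> \<open>The factor \<open>x\<close> turns p and q into u and v, so that
    \<open>mult_sinh_le\<close> applies to the doubled arguments.\<close>
  have "x * (p * (sinh v * cosh v)) \<le> x * (q * (sinh u * cosh u))"
    using mult_sinh_le[of "2 * v" "2 * u"] uv unfolding sinh_double
    by (simp add: u_def v_def mult_ac)
  then have key: "p * (sinh v * cosh v) \<le> q * (sinh u * cosh u)"
    using \<open>x > 0\<close> by simp
  have sech: "1 - (tanh y)\<^sup>2 = 1 / (cosh y)\<^sup>2" for y :: real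
    using hyperbolic_pythagoras[of y] by (simp add: tanh_def power_divide divide_simps)
  have "p * (1 - (tanh u)\<^sup>2) * tanh v - tanh u * (q * (1 - (tanh v)\<^sup>2))
      = (p * (sinh v * cosh v) - q * (sinh u * cosh u)) / ((cosh u)\<^sup>2 * (cosh v)\<^sup>2)"
    unfolding sech by (simp add: tanh_def field_simps power2_eq_square)
  also have "\<dots> \<le> 0"
    using key by (simp add: divide_le_0_iff)
  finally have "(p * (1 - (tanh u)\<^sup>2) * tanh v - tanh u * (q * (1 - (tanh v)\<^sup>2))) / (tanh v * tanh v) \<le> 0"
    by (simp add: divide_le_0_iff)
  moreover have "((\<lambda>x. tanh (x * p) / tanh (x * q)) has_real_derivative
      (p * (1 - (tanh u)\<^sup>2) * tanh v - tanh u * (q * (1 - (tanh v)\<^sup>2))) / (tanh v * tanh v)) (at x)"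
    using uv unfolding u_def v_def by (auto intro!: derivative_eq_intros simp: mult_ac)
  ultimately show "\<exists>y. ((\<lambda>x. tanh (x * p) / tanh (x * q)) has_real_derivative y) (at x) \<and> y \<le> 0"
    by blast
qed

lemma tanh_less_self:
  fixes x :: real
  assumes "x > 0"
  shows "tanh x < x"
proof -
  have "x - tanh x > 0 - tanh 0"
  proof (rule DERIV_pos_imp_increasing_open[OF assms])
    fix y assume "0 < y" "y < x"
    have "((\<lambda>y. y - tanh y) has_real_derivative (tanh y)\<^sup>2) (at y)"
      by (auto intro!: derivative_eq_intros)
    moreover have "(tanh y)\<^sup>2 > 0" using \<open>0 < y\<close> by simp
    ultimately show "\<exists>d. ((\<lambda>y. y - tanh y) has_real_derivative d) (at y) \<and> d > 0" by blast
  qed (auto intro!: continuous_intros)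
  then show ?thesis by simp
qed

lemma scaled_tanh_minus: "scaled_tanh \<beta> (- x) = - scaled_tanh \<beta> x"
  by (simp add: scaled_tanh_def)

lemma scaled_tanh_mono: "\<beta> > 0 \<Longrightarrow> x \<le> y \<Longrightarrow> scaled_tanh \<beta> x \<le> scaled_tanh \<beta> y"
  by (simp add: scaled_tanh_def divide_right_mono)

lemma scaled_tanh_pos_iff: "\<beta> > 0 \<Longrightarrow> scaled_tanh \<beta> x > 0 \<longleftrightarrow> x > 0"
  by (simp add: scaled_tanh_def zero_less_divide_iff zero_less_mult_iff)

text \<open>Compression moves even the entries 1 and -1 strictly inside the interval, which supplies
  the gap that coercivity of the Elo loss needs.\<close>

lemma scaled_tanh_1_less_1: "\<beta> > 0 \<Longrightarrow> scaled_tanh \<beta> 1 < 1"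
  using tanh_less_self[of \<beta>] by (simp add: scaled_tanh_def)

lemma abs_scaled_tanh_le:
  assumes "\<beta> > 0" "\<bar>x\<bar> \<le> y"
  shows "\<bar>scaled_tanh \<beta> x\<bar> \<le> scaled_tanh \<beta> y"
  using scaled_tanh_mono[of \<beta> x y] scaled_tanh_mono[of \<beta> "- x" y] assms
  by (simp add: scaled_tanh_minus abs_le_iff)

lemma map_matrix_nth: "map_matrix f A $ i $ j = f (A $ i $ j)"
  by (simp add: map_matrix_def)

lemma is_game_scaled_tanh:
  assumes "\<beta> > 0" "is_game P"
  shows "is_game (map_matrix (scaled_tanh \<beta>) P)"
proof -
  have "- 1 \<le> scaled_tanh \<beta> (P $ i $ j) \<and> scaled_tanh \<beta> (P $ i $ j) \<le> 1" for i j
    using abs_scaled_tanh_le[OF assms(1) game_abs_le_1[OF assms(2)], of i j]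
      scaled_tanh_1_less_1[OF assms(1)] by linarith
  moreover have "map_matrix (scaled_tanh \<beta>) P = - transpose (map_matrix (scaled_tanh \<beta>) P)"
    unfolding vec_eq_iff
  proof (intro allI)
    fix i j
    show "map_matrix (scaled_tanh \<beta>) P $ i $ j = (- transpose (map_matrix (scaled_tanh \<beta>) P)) $ i $ j"
      by (simp add: map_matrix_nth transpose_def game_antisym[OF assms(2), of j i] scaled_tanh_minus)
  qed
  ultimately show ?thesis
    by (simp add: is_game_def map_matrix_nth)
qed

lemma regular_game_scaled_tanh:
  "\<beta> > 0 \<Longrightarrow> regular_game P \<Longrightarrow> regular_game (map_matrix (scaled_tanh \<beta>) P)"
  unfolding regular_game_def by (simp add: map_matrix_nth scaled_tanh_def)

lemma transitive_game_scaled_tanh: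
  "\<beta> > 0 \<Longrightarrow> transitive_game P \<Longrightarrow> transitive_game (map_matrix (scaled_tanh \<beta>) P)"
  unfolding transitive_game_def map_matrix_nth using scaled_tanh_pos_iff by blast

section \<open>Extreme entries and the row sum comparison\<close>

lemma finite_entries: "finite {A $ i $ j | i j :: 'n::finite. Q i j}"
  by (rule finite_subset[of _ "(\<lambda>(i, j). A $ i $ j) ` UNIV"]) auto

lemma le_P_max: "P $ i $ j \<le> P_max P"
  unfolding P_max_def by (rule Max_ge[OF finite_entries]) auto

lemma P_min_le: "P $ i $ j > 0 \<Longrightarrow> P_min P \<le> P $ i $ j"
  unfolding P_min_def by (rule Min_le[OF finite_entries]) auto

text \<open>The positive entry makes the set under \<open>Min\<close> nonempty.\<close>

lemma P_min_pos: "P $ i $ j > 0 \<Longrightarrow> P_min P > 0"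
  unfolding P_min_def by (subst Min_gr_iff[OF finite_entries]) auto

text \<open>The ratio condition is assumed at \<open>b\<close> and passed on to
  \<open>\<beta>\<close>, where it says that the row sum gap n m - (n - 2) M is positive.\<close>

lemma elo_rating_scaled_tanh_represents_wins:
  fixes P :: "real^'n^'n"
  assumes game: "is_game P" and regular: "regular_game P" and trans: "transitive_game P"
    and b: "0 < b" "b \<le> \<beta>"
    and ratio: "(real CARD('n) - 2) * (tanh (b * P_max P) / tanh (b * P_min P)) < real CARD('n)"
    and elo: "is_elo_rating (map_matrix (scaled_tanh \<beta>) P) e"
  shows "represents_wins P e"
proof (rule represents_winsI[OF game regular])
  fix i j assume ij: "P $ i $ j > 0"
  define Q where "Q = map_matrix (scaled_tanh \<beta>) P"
  \<comment> \<open>By monotonicity these bound the positive entries of the compressed game.\<close>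
  define m M where "m = scaled_tanh \<beta> (P_min P)" and "M = scaled_tanh \<beta> (P_max P)"
  have "\<beta> > 0" using b by simp
  have P_min: "P_min P > 0" "P_min P \<le> P_max P"
    using P_min_pos[OF ij] P_min_le[OF ij] le_P_max[of P i j] by auto
  have m: "0 < m" "m \<le> M"
    using P_min \<open>\<beta> > 0\<close> by (simp_all add: m_def M_def scaled_tanh_pos_iff scaled_tanh_mono)
  \<comment> \<open>Two distinct players give n \<ge> 2, so multiplying by n - 2 preserves the ratio
    inequality.\<close>
  have "i \<noteq> j" using ij game_diag[OF game, of i] by auto
  then have "card {i, j} \<le> CARD('n)" by (intro card_mono) auto
  then have "real CARD('n) - 2 \<ge> 0" using \<open>i \<noteq> j\<close> by simp
  \<comment> \<open>The prefactor 1 / \<beta> cancels in M / m.\<close>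
  have "(real CARD('n) - 2) * (M / m)
      = (real CARD('n) - 2) * (tanh (\<beta> * P_max P) / tanh (\<beta> * P_min P))"
    using \<open>\<beta> > 0\<close> by (simp add: m_def M_def scaled_tanh_def)
  also have "\<dots> \<le> (real CARD('n) - 2) * (tanh (b * P_max P) / tanh (b * P_min P))"
    using \<open>real CARD('n) - 2 \<ge> 0\<close> P_min b by (intro mult_left_mono tanh_ratio_antimono)
  also note ratio
  finally have "(real CARD('n) - 2) * M < real CARD('n) * m"
    using m by (simp add: field_simps)
  moreover have "real CARD('n) * m - (real CARD('n) - 2) * M
      \<le> (\<Sum>k\<in>UNIV. Q $ i $ k) - (\<Sum>k\<in>UNIV. Q $ j $ k)"
  proof (rule transitive_row_sum_diff_ge)
    show "is_game Q" "regular_game Q" "transitive_game Q"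
      unfolding Q_def using game regular trans \<open>\<beta> > 0\<close>
      by (simp_all add: is_game_scaled_tanh regular_game_scaled_tanh transitive_game_scaled_tanh)
    show "m \<le> Q $ i $ j" if "Q $ i $ j > 0" for i j
      using that \<open>\<beta> > 0\<close> P_min_le[of P i j]
      by (simp add: Q_def m_def map_matrix_nth scaled_tanh_pos_iff scaled_tanh_mono)
    show "Q $ i $ j \<le> M" for i j
      using \<open>\<beta> > 0\<close> by (simp add: Q_def M_def map_matrix_nth scaled_tanh_mono le_P_max)
    show "Q $ i $ j > 0"
      using ij \<open>\<beta> > 0\<close> by (simp add: Q_def map_matrix_nth scaled_tanh_pos_iff)
  qed (use m in auto)
  ultimately have "(\<Sum>k\<in>UNIV. Q $ j $ k) < (\<Sum>k\<in>UNIV. Q $ i $ k)" by simp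
  then show "e $ j < e $ i"
    unfolding Q_def by (rule elo_rating_less[OF is_game_scaled_tanh[OF \<open>\<beta> > 0\<close> game] elo])
qed

theorem theorem2:
  fixes P :: "real^'n^'n"
  assumes "CARD('n) \<ge> 2" and "is_game P" and "regular_game P"
  shows "(transitive_game P \<longleftrightarrow> weak_separable_ordinal_potential_game P) \<and>
    (transitive_game P \<longleftrightarrow> (\<exists>\<Phi>. represents_wins P \<Phi>)) \<and>
    (transitive_game P \<longrightarrow>
      (\<forall>\<alpha> \<beta>\<^sub>\<alpha> \<beta>.
        0 < \<alpha> \<and> \<alpha> < 2 / (real CARD('n) * (real CARD('n) - 1)) \<and>
        \<beta>\<^sub>\<alpha> > 0 \<and>
        tanh (\<beta>\<^sub>\<alpha> * P_max P) / tanh (\<beta>\<^sub>\<alpha> * P_min P)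
          \<le> real CARD('n) / (real CARD('n) - 2 + real CARD('n) * (real CARD('n) - 1) * \<alpha>) \<and>
        \<beta> > max ((real CARD('n) - 1) / x_root \<alpha>) \<beta>\<^sub>\<alpha> \<longrightarrow>
        (\<exists>\<epsilon>. is_elo_rating (map_matrix (scaled_tanh \<beta>) P) \<epsilon>) \<and>
        (\<forall>\<epsilon>. is_elo_rating (map_matrix (scaled_tanh \<beta>) P) \<epsilon> \<longrightarrow> represents_wins P \<epsilon>)))"
proof (intro conjI impI allI)
  let ?n = "real CARD('n)"
  show "transitive_game P \<longleftrightarrow> (\<exists>\<Phi>. represents_wins P \<Phi>)"
    using transitive_imp_represents_wins[OF assms(2,3)] represents_wins_imp_transitive by blast
  then show "transitive_game P \<longleftrightarrow> weak_separable_ordinal_potential_game P"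
    by (simp add: weak_separable_iff_represents_wins[OF assms(2)])
  fix \<alpha> b \<beta> :: real
  assume trans: "transitive_game P" and
    params: "0 < \<alpha> \<and> \<alpha> < 2 / (?n * (?n - 1)) \<and> b > 0 \<and>
      tanh (b * P_max P) / tanh (b * P_min P) \<le> ?n / (?n - 2 + ?n * (?n - 1) * \<alpha>) \<and>
      \<beta> > max ((?n - 1) / x_root \<alpha>) b"
  have n: "?n \<ge> 2" using assms(1) by simp
  have \<beta>: "0 < b" "b \<le> \<beta>" "\<beta> > 0" using params by auto
  \<comment> \<open>Entries of modulus at most 1 are compressed to modulus at most the value at 1,
    which is less than 1.\<close>
  show "\<exists>\<epsilon>. is_elo_rating (map_matrix (scaled_tanh \<beta>) P) \<epsilon>"
    using abs_scaled_tanh_le[OF \<beta>(3) game_abs_le_1[OF assms(2)]] scaled_tanh_1_less_1[OF \<beta>(3)]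
    by (intro elo_rating_exists[of _ "scaled_tanh \<beta> 1"]) (simp_all add: map_matrix_nth)
  fix \<epsilon>
  assume elo: "is_elo_rating (map_matrix (scaled_tanh \<beta>) P) \<epsilon>"
  \<comment> \<open>The excess of the denominator over n - 2; its positivity makes the last estimate
    strict.\<close>
  define a where "a = ?n * (?n - 1) * \<alpha>"
  have "a > 0" using n params by (simp add: a_def)
  have "(?n - 2) * (tanh (b * P_max P) / tanh (b * P_min P)) \<le> (?n - 2) * (?n / (?n - 2 + a))"
    using n params by (intro mult_left_mono) (auto simp: a_def)
  also have "\<dots> < ?n"
    using n \<open>a > 0\<close> by (simp add: divide_less_eq algebra_simps)
  finally show "represents_wins P \<epsilon>"
    using elo_rating_scaled_tanh_represents_wins[OF assms(2,3) trans \<beta>(1,2) _ elo] by blast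
qed

end
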